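(* Consider the loss network with $s$ resources of capacities $\mathbf b\in\mathbf R_+^s$ and $m$ request classes with parameters $\lambda_i,\mu_i,r_i$ and admissible allocation sets $\mathcal B_i=\{\mathbf b_{i1},\dots,\mathbf b_{il_i}\}\subset\mathbf R_+^s$, $\rho_i=\lambda_i/\mu_i$, initially empty. For $t\ge0$ let $R^*(t)$ be the optimal value of the linear program $$\max_\alpha\ \sum_{i=1}^mr_i\rho_i\sum_{j=1}^{l_i}\alpha_{ij}\quad\text{s.t.}\quad\sum_{i=1}^m\rho_i\sum_{j=1}^{l_i}\mathbf b_{ij}\alpha_{ij}\le\mathbf b,\quad\sum_{j=1}^{l_i}\alpha_{ij}\le1-e^{-\mu_it}\ \forall i,\quad\alpha_{ij}\ge0\ \forall i,j.$$ Let $(\alpha_{ij}^* )$ be an optimal solution of the steady state linear program $$\max_\alpha\ \sum_{i=1}^mr_i\rho_i\sum_{j=1}^{l_i}\alpha_{ij}\quad\text{s.t.}\quad\sum_{i=1}^m\rho_i\sum_{j=1}^{l_i}\mathbf b_{ij}\alpha_{ij}\le\mathbf b,\quad\sum_{j=1}^{l_i}\alpha_{ij}\le1\ \forall i,\quad\alpha_{ij}\ge0\ \forall i,j,$$ set $\alpha_i^*=\sum_{j=1}^{l_i}\alpha_{ij}^*$, and let $(\mathbf u^*,\mathbf v^* )$ be an optimal solution of its dual $$\min_{\mathbf u,\mathbf v}\ \mathbf b^T\mathbf u+\mathbf 1^T\mathbf v\quad\text{s.t.}\quad\rho_ir_i\le v_i+\rho_i\mathbf u^T\mathbf b_{ij}\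 \forall j=1,\dots,l_i,\ i=1,\dots,m,\quad\mathbf v\ge\mathbf 0,\ \mathbf u\ge\mathbf 0.$$ Then for every feasible policy $\pi$ and every $t\ge0$, $$\mathbf E[R^\pi(t)]\le R^*(t)\le\min\Big\{\sum_{i=1}^mr_i\rho_i(1-e^{-\mu_it}),\ \sum_{i=1}^mr_i\rho_i\alpha_i^*(1-e^{-\mu_it})+(\mathbf u^* )^T\mathbf b\,e^{-\mu_{\min}t}\Big\},$$ where $\mu_{\min}=\min_{1\le i\le m}\mu_i$.
   Context: Loss network. There are $s$ resources; resource $k$ has capacity $b(k)\ge0$, and $\mathbf b=(b(1),\dots,b(s))$. Requests belong to $m$ independent Poisson arrival classes; class $i$ has arrival rate $\lambda_i>0$, independent service durations $S_i\sim\exp(\mu_i)$ (rate $\mu_i>0$), accepts any capacity allocation in the finite set $\mathcal B_i=\{\mathbf b_{i1},\dots,\mathbf b_{il_i}\}$, $\mathbf b_{ij}\in\mathbf R_+^s$, and pays $r_i\ge0$ per unit time while in service. There is no waiting room: each arriving class $i$ request is immediately either rejected or assigned some allocation $\mathbf b_{ij}\in\mathcal B_i$, which it occupies for its service duration, releasing all resources simultaneously on departure. The system is initially empty. Requests may be rejected even if capacity is available. Vector inequalities are componentwise. A feasible policy $\pi$ chooses at each arrival epoch an action in $\{0,1,\dots,l_i\}$ ($0$ = reject, $j\ge1$ = assign $\mathbf b_{ij}$), measurable with respect to the $\sigma$-algebra generated by the arrival epochs up to that time, the past actions and the past of the state process, so that $\sum_{i=1}^m\sum_{j=1}^{l_i}x_{ij}^\pi(t)\mathbf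 b_{ij}\le\mathbf b$ for all $t\ge0$, where $x_{ij}^\pi(t)$ is the number of class $i$ requests in the system at time $t$ assigned to $\mathbf b_{ij}$. The reward rate is $R^\pi(t)=\sum_{i=1}^mr_i\sum_{j=1}^{l_i}x_{ij}^\pi(t)$. *)

theory Defs
  imports "HOL-Probability.Probability"
begin

text \<open>
  Request classes are the elements of a finite type \<open>'c\<close>, resources those of a finite type
  \<open>'k\<close>; the order on \<open>real ^ 'k\<close> is componentwise.  Class \<open>i\<close> has allocations
  \<open>B i 1, \<dots>, B i (l i)\<close>.  Requests of class \<open>i\<close> are numbered from \<open>0\<close>: \<open>X i n\<close> is the time between
  the \<open>(n-1)\<close>-st and the \<open>n\<close>-th arrival (for \<open>n = 0\<close>, the time until the first arrival), \<open>S i n\<close> is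
  the service duration attached to the \<open>n\<close>-th request, and \<open>a i n\<close> is the action taken for it.
\<close>

definition arrival_epoch :: "('c \<Rightarrow> nat \<Rightarrow> 'w \<Rightarrow> real) \<Rightarrow> 'c \<Rightarrow> nat \<Rightarrow> 'w \<Rightarrow> real" where
  "arrival_epoch X i n \<omega> = (\<Sum>k\<le>n. X i k \<omega>)"

text \<open>
  For Poisson arrivals the set below is almost surely finite.  Only \<open>j \<ge> 1\<close> is meaningful, since
  \<open>a i n \<omega> = 0\<close> means that the request is rejected.
\<close>

definition state ::
  "('c \<Rightarrow> nat \<Rightarrow> 'w \<Rightarrow> real) \<Rightarrow> ('c \<Rightarrow> nat \<Rightarrow> 'w \<Rightarrow> real) \<Rightarrow> ('c \<Rightarrow> nat \<Rightarrow> 'w \<Rightarrow> nat)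
    \<Rightarrow> 'c \<Rightarrow> nat \<Rightarrow> real \<Rightarrow> 'w \<Rightarrow> nat" where
  "state X S a i j t \<omega> = card {n. a i n \<omega> = j \<and>
     arrival_epoch X i n \<omega> \<le> t \<and> t < arrival_epoch X i n \<omega> + S i n \<omega>}"

definition reward_rate ::
  "('c::finite \<Rightarrow> real) \<Rightarrow> ('c \<Rightarrow> nat) \<Rightarrow> ('c \<Rightarrow> nat \<Rightarrow> 'w \<Rightarrow> real) \<Rightarrow> ('c \<Rightarrow> nat \<Rightarrow> 'w \<Rightarrow> real)
    \<Rightarrow> ('c \<Rightarrow> nat \<Rightarrow> 'w \<Rightarrow> nat) \<Rightarrow> real \<Rightarrow> 'w \<Rightarrow> real" where
  "reward_rate r l X S a t \<omega> = (\<Sum>i\<in>UNIV. r i * (\<Sum>j=1..l i. real (state X S a i j t \<omega>)))"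

definition generated_sigma :: "'w set \<Rightarrow> ('w \<Rightarrow> ereal) set \<Rightarrow> 'w measure" where
  "generated_sigma \<Omega> F = sigma \<Omega> {f -` E \<inter> \<Omega> | f E. f \<in> F \<and> E \<in> sets borel}"

text \<open>
  The information available when the \<open>n\<close>-th request of class \<open>i\<close> arrives, at the random time \<open>T\<close>:
  arrival epochs up to and including \<open>T\<close>, actions taken strictly before \<open>T\<close>, and the state process
  strictly before \<open>T\<close>.  Arrivals after \<open>T\<close> are masked by \<open>\<infinity>\<close>.  As \<open>T\<close> itself is one of the
  generators, masking actions and states by \<open>0\<close> loses no information.
\<close>

definition history ::
  "'w set \<Rightarrow> ('c \<Rightarrow> nat) \<Rightarrow> ('c \<Rightarrow> nat \<Rightarrow> 'w \<Rightarrow> real) \<Rightarrow> ('c \<Rightarrow> nat \<Rightarrow> 'w \<Rightarrow> real)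
    \<Rightarrow> ('c \<Rightarrow> nat \<Rightarrow> 'w \<Rightarrow> nat) \<Rightarrow> 'c \<Rightarrow> nat \<Rightarrow> 'w measure" where
  "history \<Omega> l X S a i n = (let T = arrival_epoch X i n in generated_sigma \<Omega>
     ({\<lambda>\<omega>. if arrival_epoch X i' k \<omega> \<le> T \<omega> then ereal (arrival_epoch X i' k \<omega>) else \<infinity> | i' k. True}
    \<union> {\<lambda>\<omega>. if arrival_epoch X i' k \<omega> < T \<omega> then ereal (real (a i' k \<omega>)) else 0 | i' k. True}
    \<union> {\<lambda>\<omega>. if t < T \<omega> then ereal (real (state X S a i' j t \<omega>)) else 0
         | i' j t. j \<in> {1..l i'} \<and> 0 \<le> t}))"

definition feasible_policy ::
  "'w measure \<Rightarrow> real ^ 'k::finite \<Rightarrow> ('c::finite \<Rightarrow> nat) \<Rightarrow> ('c \<Rightarrow> nat \<Rightarrow> real ^ 'k)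
    \<Rightarrow> ('c \<Rightarrow> nat \<Rightarrow> 'w \<Rightarrow> real) \<Rightarrow> ('c \<Rightarrow> nat \<Rightarrow> 'w \<Rightarrow> real) \<Rightarrow> ('c \<Rightarrow> nat \<Rightarrow> 'w \<Rightarrow> nat) \<Rightarrow> bool" where
  "feasible_policy M b l B X S a \<longleftrightarrow>
     (\<forall>i n. a i n \<in> M \<rightarrow>\<^sub>M count_space UNIV) \<and>
     (\<forall>i n. a i n \<in> history (space M) l X S a i n \<rightarrow>\<^sub>M count_space UNIV) \<and>
     (\<forall>i n. \<forall>\<omega>\<in>space M. a i n \<omega> \<in> {0..l i}) \<and>
     (AE \<omega> in M. \<forall>t\<ge>0. (\<Sum>i\<in>UNIV. \<Sum>j=1..l i. real (state X S a i j t \<omega>) *\<^sub>R B i j) \<le> b)"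

text \<open>
  The two primal linear programs differ only in the bound \<open>c i\<close> on \<open>\<Sum>j. \<alpha> i j\<close>.  Values of \<open>\<alpha> i j\<close>
  with \<open>j\<close> outside \<open>{1..l i}\<close> play no role.
\<close>

definition lp_objective ::
  "('c::finite \<Rightarrow> real) \<Rightarrow> ('c \<Rightarrow> real) \<Rightarrow> ('c \<Rightarrow> nat) \<Rightarrow> ('c \<Rightarrow> nat \<Rightarrow> real) \<Rightarrow> real" where
  "lp_objective r \<rho> l \<alpha> = (\<Sum>i\<in>UNIV. r i * \<rho> i * (\<Sum>j=1..l i. \<alpha> i j))"

definition lp_feasible ::
  "real ^ 'k::finite \<Rightarrow> ('c::finite \<Rightarrow> real) \<Rightarrow> ('c \<Rightarrow> nat) \<Rightarrow> ('c \<Rightarrow> nat \<Rightarrow> real ^ 'k)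
    \<Rightarrow> ('c \<Rightarrow> real) \<Rightarrow> ('c \<Rightarrow> nat \<Rightarrow> real) \<Rightarrow> bool" where
  "lp_feasible b \<rho> l B c \<alpha> \<longleftrightarrow>
     (\<Sum>i\<in>UNIV. \<rho> i *\<^sub>R (\<Sum>j=1..l i. \<alpha> i j *\<^sub>R B i j)) \<le> b \<and>
     (\<forall>i. (\<Sum>j=1..l i. \<alpha> i j) \<le> c i) \<and>
     (\<forall>i. \<forall>j\<in>{1..l i}. 0 \<le> \<alpha> i j)"

definition lp_optimal ::
  "real ^ 'k::finite \<Rightarrow> ('c::finite \<Rightarrow> real) \<Rightarrow> ('c \<Rightarrow> real) \<Rightarrow> ('c \<Rightarrow> nat) \<Rightarrow> ('c \<Rightarrow> nat \<Rightarrow> real ^ 'k)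
    \<Rightarrow> ('c \<Rightarrow> real) \<Rightarrow> ('c \<Rightarrow> nat \<Rightarrow> real) \<Rightarrow> bool" where
  "lp_optimal b r \<rho> l B c \<alpha> \<longleftrightarrow> lp_feasible b \<rho> l B c \<alpha> \<and>
     (\<forall>\<alpha>'. lp_feasible b \<rho> l B c \<alpha>' \<longrightarrow> lp_objective r \<rho> l \<alpha>' \<le> lp_objective r \<rho> l \<alpha>)"

text \<open>
  For \<open>b \<ge> 0\<close> and \<open>c \<ge> 0\<close> the feasible set is nonempty and the objective is bounded on it, so the
  supremum of reals below is proper; by compactness it is attained.
\<close>

definition lp_value ::
  "real ^ 'k::finite \<Rightarrow> ('c::finite \<Rightarrow> real) \<Rightarrow> ('c \<Rightarrow> real) \<Rightarrow> ('c \<Rightarrow> nat) \<Rightarrow> ('c \<Rightarrow> nat \<Rightarrow> real ^ 'k)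
    \<Rightarrow> ('c \<Rightarrow> real) \<Rightarrow> real" where
  "lp_value b r \<rho> l B c = Sup {lp_objective r \<rho> l \<alpha> | \<alpha>. lp_feasible b \<rho> l B c \<alpha>}"

definition dual_objective :: "real ^ 'k::finite \<Rightarrow> real ^ 'k \<Rightarrow> real ^ 'c::finite \<Rightarrow> real" where
  "dual_objective b u v = b \<bullet> u + (\<Sum>i\<in>UNIV. v $ i)"

definition dual_feasible ::
  "('c::finite \<Rightarrow> real) \<Rightarrow> ('c \<Rightarrow> real) \<Rightarrow> ('c \<Rightarrow> nat) \<Rightarrow> ('c \<Rightarrow> nat \<Rightarrow> real ^ 'k::finite)
    \<Rightarrow> real ^ 'k \<Rightarrow> real ^ 'c \<Rightarrow> bool" where
  "dual_feasible r \<rho> l B u v \<longleftrightarrow>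
     (\<forall>i. \<forall>j\<in>{1..l i}. \<rho> i * r i \<le> v $ i + \<rho> i * (u \<bullet> B i j)) \<and> 0 \<le> v \<and> 0 \<le> u"

definition dual_optimal ::
  "real ^ 'k::finite \<Rightarrow> ('c::finite \<Rightarrow> real) \<Rightarrow> ('c \<Rightarrow> real) \<Rightarrow> ('c \<Rightarrow> nat) \<Rightarrow> ('c \<Rightarrow> nat \<Rightarrow> real ^ 'k)
    \<Rightarrow> real ^ 'k \<Rightarrow> real ^ 'c \<Rightarrow> bool" where
  "dual_optimal b r \<rho> l B u v \<longleftrightarrow> dual_feasible r \<rho> l B u v \<and>
     (\<forall>u' v'. dual_feasible r \<rho> l B u' v' \<longrightarrow> dual_objective b u v \<le> dual_objective b u' v')"

end

theory Submission
  imports Defs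
begin

text \<open>
  The vector \<open>\<alpha>' i j = E[x\<^sub>i\<^sub>j(t)] / \<rho> i\<close> is feasible for the linear program at time \<open>t\<close>, and its
  objective value is the expected reward rate; this gives the first inequality.  The capacity
  constraint holds almost surely and is linear in the state, so it survives taking expectations.  For the
  constraint on class \<open>i\<close>, compare with the queue in which every request of class \<open>i\<close> is accepted:
  its arrivals and service durations are the same, so on every path it contains at time \<open>t\<close> all
  class \<open>i\<close> requests that the policy has in service, and it is an infinite-server queue, whose mean
  content is \<open>\<rho> i * (1 - exp (- \<mu> i * t))\<close> (\<open>nn_integral_infinite_server_queue\<close>).

  For the second inequality, \<open>(u, v)\<close> is feasible also for the dual of the program at time \<open>t\<close>, because
  time enters that dual only through its objective.  Weak duality bounds the value by
  \<open>u \<bullet> b + (\<Sum>i. v i * (1 - exp (- \<mu> i * t)))\<close>.  It remains to compare this number with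
  the steady state solution \<open>\<alpha>\<close>.  By strong duality the steady state program gives
  \<open>u \<bullet> b + (\<Sum>i. v i) \<le> (\<Sum>i. w i)\<close>, where \<open>w i\<close> is the contribution of class \<open>i\<close> to
  the objective.  Dual feasibility gives \<open>w i \<le> v i + q i\<close>, where \<open>q i \<ge> 0\<close> is the price of the
  resources that \<open>\<alpha>\<close> assigns to class \<open>i\<close>, and \<open>(\<Sum>i. q i) \<le> u \<bullet> b\<close>.  Multiply the
  inequality for class \<open>i\<close> by \<open>exp (- \<mu> i * t)\<close>, replace this factor in front of \<open>q i\<close> by the larger
  \<open>exp (- Min (range \<mu>) * t)\<close>, sum over the classes and add the result to the strong duality
  inequality: this is the bound (\<open>discounted_dual_value_le\<close>).

  Strong duality (\<open>lp_strong_duality\<close>) rests on Farkas' lemma, that is, on the separation of a point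
  from a finitely generated convex cone, which is closed.
\<close>

section \<open>Linear programming duality\<close>

text \<open>
  A finitely generated cone is closed and convex.  Hence if \<open>d\<close> were not in the cone generated by the
  \<open>g p\<close>, the normal \<open>w\<close> of a separating hyperplane would satisfy all inequalities \<open>0 \<le> g p \<bullet> w\<close> but not
  \<open>0 \<le> d \<bullet> w\<close>.
\<close>

lemma farkas:
  fixes g :: "'i \<Rightarrow> 'a::euclidean_space" and d :: 'a
  assumes fin: "finite I"
    and implied: "\<And>w. (\<forall>p\<in>I. 0 \<le> g p \<bullet> w) \<Longrightarrow> 0 \<le> d \<bullet> w"
  obtains y where "\<And>p. p \<in> I \<Longrightarrow> 0 \<le> y p" "d = (\<Sum>p\<in>I. y p *\<^sub>R g p)"
proof -
  let ?C = "convex_cone hull (g ` I)"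
  let ?K = "{\<Sum>p\<in>I. y p *\<^sub>R g p | y. \<forall>p\<in>I. 0 \<le> y p}"
  have "d \<in> ?C"
  proof (rule ccontr)
    assume "d \<notin> ?C"
    then obtain w \<beta> where w: "w \<bullet> d < \<beta>" "\<And>x. x \<in> ?C \<Longrightarrow> \<beta> < w \<bullet> x"
      using separating_hyperplane_closed_point[OF convex_convex_cone_hull closed_convex_cone_hull] fin
      by (metis finite_imageI)
    have "\<beta> < 0"
      using w(2)[OF convex_cone_hull_contains_0] by simp
    have "0 \<le> g p \<bullet> w" if "p \<in> I" for p
    proof (rule ccontr)
      assume neg: "\<not> 0 \<le> g p \<bullet> w"
      \<comment> \<open>Rescaling the generator moves it onto the separating hyperplane.\<close>
      have "(\<beta> / (g p \<bullet> w)) *\<^sub>R g p \<in> ?C"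
        using that neg \<open>\<beta> < 0\<close>
        by (intro convex_cone_hull_mul hull_inc) (auto simp: divide_nonpos_neg)
      from w(2)[OF this] show False
        using neg by (simp add: inner_commute)
    qed
    then have "0 \<le> d \<bullet> w"
      by (intro implied) auto
    with w(1) \<open>\<beta> < 0\<close> show False
      by (simp add: inner_commute)
  qed
  moreover have "?C \<subseteq> ?K"
  proof (rule hull_minimal)
    show "g ` I \<subseteq> ?K"
    proof
      fix x assume "x \<in> g ` I"
      then obtain q where "q \<in> I" "x = g q" by auto
      then have "x = (\<Sum>p\<in>I. (if p = q then 1 else 0) *\<^sub>R g p)"
        using fin by (simp add: if_distrib[of "\<lambda>c. c *\<^sub>R _"] cong: if_cong)
      then show "x \<in> ?K" by fastforce
    qed
    show "convex_cone ?K"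
      unfolding convex_cone_iff
    proof (intro conjI ballI allI impI)
      show "0 \<in> ?K" by (auto intro!: exI[of _ "\<lambda>_. 0"])
    next
      fix x y assume "x \<in> ?K" "y \<in> ?K"
      then obtain f f' where "x = (\<Sum>p\<in>I. f p *\<^sub>R g p)" "\<forall>p\<in>I. 0 \<le> f p"
        "y = (\<Sum>p\<in>I. f' p *\<^sub>R g p)" "\<forall>p\<in>I. 0 \<le> f' p" by auto
      then show "x + y \<in> ?K"
        by (auto intro!: exI[of _ "\<lambda>p. f p + f' p"] simp: sum.distrib scaleR_add_left)
    next
      fix x and c :: real assume "x \<in> ?K" "0 \<le> c"
      then obtain f where "x = (\<Sum>p\<in>I. f p *\<^sub>R g p)" "\<forall>p\<in>I. 0 \<le> f p" by auto
      then show "c *\<^sub>R x \<in> ?K"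
        using \<open>0 \<le> c\<close> by (auto intro!: exI[of _ "\<lambda>p. c * f p"] simp: scaleR_sum_right)
    qed
  qed
  ultimately show ?thesis
    using that by auto
qed

text \<open>
  Here \<open>z\<close> minimises \<open>d \<bullet> z\<close> subject to the constraints \<open>h p \<le> g p \<bullet> z\<close>, and \<open>y\<close> is a system of optimal
  multipliers.  Farkas' lemma is applied in one more dimension, to the vectors \<open>(g p, h p)\<close> and
  \<open>(0, -1)\<close>: a vector \<open>(x, s)\<close> with \<open>s < 0\<close> that violates its hypothesis rescales to a feasible point
  below the optimum, and one with \<open>s = 0\<close> is a feasible direction of descent at \<open>z\<close>.
\<close>

lemma lp_strong_duality:
  fixes g :: "'i \<Rightarrow> 'a::euclidean_space" and h :: "'i \<Rightarrow> real" and d z :: 'a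
  assumes fin: "finite I"
    and feas: "\<And>p. p \<in> I \<Longrightarrow> h p \<le> g p \<bullet> z"
    and opt: "\<And>z'. (\<forall>p\<in>I. h p \<le> g p \<bullet> z') \<Longrightarrow> d \<bullet> z \<le> d \<bullet> z'"
  obtains y where "\<And>p. p \<in> I \<Longrightarrow> 0 \<le> y p" "d = (\<Sum>p\<in>I. y p *\<^sub>R g p)"
    "d \<bullet> z \<le> (\<Sum>p\<in>I. y p * h p)"
proof -
  define G :: "'i option \<Rightarrow> 'a \<times> real" where
    "G q = (case q of None \<Rightarrow> (0, -1) | Some p \<Rightarrow> (g p, h p))" for q
  have fin': "finite (insert None (Some ` I))" using fin by simp
  have impl: "0 \<le> (d, d \<bullet> z) \<bullet> w" if "\<forall>q\<in>insert None (Some ` I). 0 \<le> G q \<bullet> w" for w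
  proof -
    obtain x s where w: "w = (x, s)" by (cases w)
    have x: "0 \<le> g p \<bullet> x + h p * s" if "p \<in> I" for p
      using \<open>\<forall>q\<in>_. _\<close> that by (auto simp: G_def w)
    have s: "s \<le> 0" using that by (auto simp: G_def w)
    show ?thesis
    proof (cases "s = 0")
      case True
      then have "d \<bullet> z \<le> d \<bullet> (z + x)"
        using feas x by (intro opt) (force simp: inner_add_right)
      with True show ?thesis by (simp add: w inner_add_right)
    next
      case False
      with s have s: "s < 0" by simp
      have "d \<bullet> z \<le> d \<bullet> (x /\<^sub>R (- s))"
      proof (intro opt ballI)
        fix p assume "p \<in> I"
        from x[OF this] s show "h p \<le> g p \<bullet> (x /\<^sub>R (- s))"
          by (simp add: field_simps)
      qed
      with s show ?thesis by (simp add: w field_simps)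
    qed
  qed
  obtain y where y: "\<And>q. q \<in> insert None (Some ` I) \<Longrightarrow> 0 \<le> y q"
      and eq: "(d, d \<bullet> z) = (\<Sum>q\<in>insert None (Some ` I). y q *\<^sub>R G q)"
    using farkas[OF fin' impl] by blast
  \<comment> \<open>The multiplier of \<open>(0, -1)\<close> is the slack in the last coordinate.\<close>
  have "(\<Sum>q\<in>insert None (Some ` I). y q *\<^sub>R G q) = y None *\<^sub>R G None + (\<Sum>p\<in>I. y (Some p) *\<^sub>R G (Some p))"
    using fin by (subst sum.insert) (auto simp: sum.reindex)
  also have "\<dots> = (\<Sum>p\<in>I. y (Some p) *\<^sub>R g p, (\<Sum>p\<in>I. y (Some p) * h p) - y None)"
    by (simp add: G_def sum_prod)
  finally have "d = (\<Sum>p\<in>I. y (Some p) *\<^sub>R g p)" "d \<bullet> z = (\<Sum>p\<in>I. y (Some p) * h p) - y None"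
    using eq by auto
  with y[of None] show ?thesis
    using y by (intro that[of "\<lambda>p. y (Some p)"]) auto
qed

text \<open>
  The minimisation problem solved by \<open>(u, v)\<close> is put into the form of \<open>lp_strong_duality\<close>, with one
  constraint for each pair of a class and an allocation, and the sign constraints on the components of
  \<open>u\<close> and \<open>v\<close>.  The multipliers of the former are a solution of the primal program; those of the sign
  constraints are its slacks.
\<close>

lemma dual_optimal_le_lp_optimal:
  fixes b :: "real ^ 'k::finite" and r \<rho> :: "'c::finite \<Rightarrow> real"
  assumes primal: "lp_optimal b r \<rho> l B (\<lambda>_. 1) \<alpha>" and dual: "dual_optimal b r \<rho> l B u v"
  shows "dual_objective b u v \<le> lp_objective r \<rho> l \<alpha>"
proof -
  let ?P = "SIGMA i:UNIV. {1..l i}"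
  let ?I = "?P <+> (UNIV :: ('k + 'c) set)"
  define g :: "('c \<times> nat) + 'k + 'c \<Rightarrow> (real ^ 'k) \<times> (real ^ 'c)" where
    "g q = (case q of Inl (i, j) \<Rightarrow> (\<rho> i *\<^sub>R B i j, axis i 1)
       | Inr (Inl k) \<Rightarrow> (axis k 1, 0) | Inr (Inr i) \<Rightarrow> (0, axis i 1))" for q
  define h :: "('c \<times> nat) + 'k + 'c \<Rightarrow> real" where
    "h q = (case q of Inl (i, j) \<Rightarrow> \<rho> i * r i | Inr _ \<Rightarrow> 0)" for q
  have g_pair: "g (Inl (i, j)) \<bullet> z = snd z $ i + \<rho> i * (fst z \<bullet> B i j)" for i j z
    by (simp add: g_def inner_prod_def inner_axis inner_axis' inner_commute)
  have g_cap: "g (Inr (Inl k)) \<bullet> z = fst z $ k" and g_class: "g (Inr (Inr i)) \<bullet> z = snd z $ i" for k i z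
    by (simp_all add: g_def inner_prod_def inner_axis')
  have feas_iff: "(\<forall>q\<in>?I. h q \<le> g q \<bullet> z) \<longleftrightarrow> dual_feasible r \<rho> l B (fst z) (snd z)" for z
  proof -
    have "(\<forall>q\<in>?I. h q \<le> g q \<bullet> z) \<longleftrightarrow> (\<forall>i. \<forall>j\<in>{1..l i}. h (Inl (i, j)) \<le> g (Inl (i, j)) \<bullet> z)
      \<and> (\<forall>k. h (Inr (Inl k)) \<le> g (Inr (Inl k)) \<bullet> z) \<and> (\<forall>i. h (Inr (Inr i)) \<le> g (Inr (Inr i)) \<bullet> z)"
      (is "_ \<longleftrightarrow> ?R")
    proof
      assume R: ?R
      show "\<forall>q\<in>?I. h q \<le> g q \<bullet> z"
      proof
        fix q assume "q \<in> ?I"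
        with R show "h q \<le> g q \<bullet> z"
          by (cases q; cases "projr q") auto
      qed
    qed auto
    then show ?thesis
      unfolding g_pair g_cap g_class by (auto simp: h_def dual_feasible_def less_eq_vec_def)
  qed
  have obj: "(b, 1) \<bullet> (u', v') = dual_objective b u' v'" for u' :: "real ^ 'k" and v' :: "real ^ 'c"
    by (simp add: dual_objective_def inner_vec_def)
  have fin: "finite ?I" by (intro finite_Plus finite_SigmaI) auto
  have z: "h q \<le> g q \<bullet> (u, v)" if "q \<in> ?I" for q
    using dual feas_iff[of "(u, v)"] that by (auto simp: dual_optimal_def)
  have zopt: "(b, 1) \<bullet> (u, v) \<le> (b, 1) \<bullet> z'" if "\<forall>q\<in>?I. h q \<le> g q \<bullet> z'" for z'
    using dual feas_iff[of z'] that obj[of "fst z'" "snd z'"] obj[of u v]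
    by (auto simp: dual_optimal_def)
  obtain y where y: "\<And>q. q \<in> ?I \<Longrightarrow> 0 \<le> y q" and comb: "(b, 1) = (\<Sum>q\<in>?I. y q *\<^sub>R g q)"
    and le: "(b, 1) \<bullet> (u, v) \<le> (\<Sum>q\<in>?I. y q * h q)"
  proof (rule lp_strong_duality[where g = g and h = h and z = "(u, v)" and d = "(b, 1)", OF fin])
    show "h q \<le> g q \<bullet> (u, v)" if "q \<in> ?I" for q
      using that by (rule z)
    show "(b, 1) \<bullet> (u, v) \<le> (b, 1) \<bullet> z'" if "\<forall>q\<in>?I. h q \<le> g q \<bullet> z'" for z'
      using that by (rule zopt)
  qed (rule that)
  have y_slack: "0 \<le> y (Inr p)" for p
    by (rule y) auto
  define \<alpha>' where "\<alpha>' i j = y (Inl (i, j))" for i j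
  have split: "(\<Sum>q\<in>?I. f q) = (\<Sum>i\<in>UNIV. \<Sum>j=1..l i. f (Inl (i, j))) + (\<Sum>q\<in>UNIV. f (Inr q))"
    for f :: "_ \<Rightarrow> 'z::comm_monoid_add"
    by (subst sum.Plus) (auto simp: sum.Sigma split_def intro!: sum.cong)
  have split2: "(\<Sum>q\<in>UNIV. f q) = (\<Sum>k\<in>UNIV. f (Inl k)) + (\<Sum>i\<in>UNIV. f (Inr i))"
    for f :: "'k + 'c \<Rightarrow> 'z::comm_monoid_add"
    by (subst UNIV_Plus_UNIV[symmetric], subst sum.Plus) auto
  have b_eq: "b = (\<Sum>i\<in>UNIV. \<rho> i *\<^sub>R (\<Sum>j=1..l i. \<alpha>' i j *\<^sub>R B i j))
      + (\<Sum>k\<in>UNIV. y (Inr (Inl k)) *\<^sub>R axis k 1)"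
    using arg_cong[OF comb, of fst]
    unfolding split split2
    by (simp add: fst_sum g_def \<alpha>'_def scaleR_sum_right mult.commute)
  have one_eq: "(1 :: real ^ 'c) = (\<Sum>i\<in>UNIV. \<Sum>j=1..l i. \<alpha>' i j *\<^sub>R axis i 1)
      + (\<Sum>i\<in>UNIV. y (Inr (Inr i)) *\<^sub>R axis i 1)"
    using arg_cong[OF comb, of snd]
    unfolding split split2
    by (simp add: snd_sum g_def \<alpha>'_def)
  have "lp_feasible b \<rho> l B (\<lambda>_. 1) \<alpha>'"
    unfolding lp_feasible_def
  proof (intro conjI allI ballI)
    have "0 \<le> (\<Sum>k\<in>UNIV. y (Inr (Inl k)) *\<^sub>R axis k (1::real))"
      using y_slack by (auto simp: less_eq_vec_def axis_def intro!: sum_nonneg)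
    from add_left_mono[OF this, of "\<Sum>i\<in>UNIV. \<rho> i *\<^sub>R (\<Sum>j=1..l i. \<alpha>' i j *\<^sub>R B i j)"]
    show "(\<Sum>i\<in>UNIV. \<rho> i *\<^sub>R (\<Sum>j=1..l i. \<alpha>' i j *\<^sub>R B i j)) \<le> b"
      unfolding b_eq[symmetric] by simp
  next
    fix i
    have "1 = (\<Sum>i'\<in>UNIV. \<Sum>j=1..l i'. \<alpha>' i' j * (if i = i' then 1 else 0))
      + (\<Sum>i'\<in>UNIV. y (Inr (Inr i')) * (if i = i' then 1 else 0))"
      using arg_cong[OF one_eq, of "\<lambda>x. x $ i"] by (simp add: axis_def sum_component)
    also have "\<dots> = (\<Sum>j=1..l i. \<alpha>' i j) + y (Inr (Inr i))"
    proof -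
      have "(\<Sum>j=1..l i'. \<alpha>' i' j * (if i = i' then 1 else 0))
          = (if i = i' then \<Sum>j=1..l i'. \<alpha>' i' j else 0)" for i'
        by simp
      then show ?thesis
        by (simp add: if_distrib[of "(*) _"] cong: if_cong)
    qed
    finally show "(\<Sum>j=1..l i. \<alpha>' i j) \<le> 1"
      using y_slack[of "Inr i"] by auto
  next
    fix i j assume "j \<in> {1..l i}"
    then show "0 \<le> \<alpha>' i j"
      unfolding \<alpha>'_def by (intro y InlI SigmaI) auto
  qed
  moreover have "(\<Sum>q\<in>?I. y q * h q) = lp_objective r \<rho> l \<alpha>'"
    unfolding split split2
    by (simp add: h_def lp_objective_def \<alpha>'_def sum_distrib_left mult_ac)
  ultimately show ?thesis
    using primal le obj[of u v] unfolding lp_optimal_def by fastforce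
qed

lemma inner_mono_nonneg:
  fixes u x y :: "real ^ 'n"
  assumes "0 \<le> u" "x \<le> y"
  shows "u \<bullet> x \<le> u \<bullet> y"
  using assms by (auto simp: inner_vec_def less_eq_vec_def intro!: sum_mono mult_left_mono)

text \<open>
  The bound is kept separate for each class, because \<open>discounted_dual_value_le\<close> weights the classes
  differently.
\<close>

lemma class_objective_le_dual_price:
  assumes dual: "dual_feasible r \<rho> l B u v" and nonneg: "\<And>j. j \<in> {1..l i} \<Longrightarrow> 0 \<le> \<alpha> i j"
  shows "r i * \<rho> i * (\<Sum>j=1..l i. \<alpha> i j)
    \<le> v $ i * (\<Sum>j=1..l i. \<alpha> i j) + u \<bullet> (\<rho> i *\<^sub>R (\<Sum>j=1..l i. \<alpha> i j *\<^sub>R B i j))"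
proof -
  have "(\<Sum>j=1..l i. (\<rho> i * r i) * \<alpha> i j) \<le> (\<Sum>j=1..l i. (v $ i + \<rho> i * (u \<bullet> B i j)) * \<alpha> i j)"
    using dual nonneg by (intro sum_mono mult_right_mono) (auto simp: dual_feasible_def)
  then show ?thesis
    by (simp add: inner_sum_right sum_distrib_left sum.distrib algebra_simps)
qed

lemma lp_weak_duality:
  assumes dual: "dual_feasible r \<rho> l B u v" and primal: "lp_feasible b \<rho> l B c \<alpha>"
  shows "lp_objective r \<rho> l \<alpha> \<le> u \<bullet> b + (\<Sum>i\<in>UNIV. v $ i * c i)"
proof -
  have "lp_objective r \<rho> l \<alpha> \<le> (\<Sum>i\<in>UNIV. v $ i * c i + u \<bullet> (\<rho> i *\<^sub>R (\<Sum>j=1..l i. \<alpha> i j *\<^sub>R B i j)))"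
    unfolding lp_objective_def
  proof (rule sum_mono)
    fix i
    have "v $ i * (\<Sum>j=1..l i. \<alpha> i j) \<le> v $ i * c i"
      using dual primal by (intro mult_left_mono) (auto simp: dual_feasible_def lp_feasible_def less_eq_vec_def)
    then show "r i * \<rho> i * (\<Sum>j=1..l i. \<alpha> i j)
        \<le> v $ i * c i + u \<bullet> (\<rho> i *\<^sub>R (\<Sum>j=1..l i. \<alpha> i j *\<^sub>R B i j))"
      using class_objective_le_dual_price[OF dual, of i \<alpha>] primal by (auto simp: lp_feasible_def)
  qed
  also have "\<dots> = (\<Sum>i\<in>UNIV. v $ i * c i) + u \<bullet> (\<Sum>i\<in>UNIV. \<rho> i *\<^sub>R (\<Sum>j=1..l i. \<alpha> i j *\<^sub>R B i j))"
    by (simp add: sum.distrib inner_sum_right)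
  also have "\<dots> \<le> (\<Sum>i\<in>UNIV. v $ i * c i) + u \<bullet> b"
    using dual primal by (intro add_left_mono inner_mono_nonneg) (auto simp: dual_feasible_def lp_feasible_def)
  finally show ?thesis by simp
qed

text \<open>
  With \<open>e i = exp (- \<mu> i * t)\<close> the left-hand side is the value of the steady state dual solution in the
  dual of the program at time \<open>t\<close>.  Below, \<open>w i\<close> is what class \<open>i\<close> contributes to the optimal steady
  state objective, and \<open>q i\<close> is the price of the resources allotted to it.
\<close>

lemma discounted_dual_value_le:
  fixes e :: "'c::finite \<Rightarrow> real"
  assumes primal: "lp_optimal b r \<rho> l B (\<lambda>_. 1) \<alpha>" and dual: "dual_optimal b r \<rho> l B u v"
    and allocations: "\<And>i j. j \<in> {1..l i} \<Longrightarrow> 0 \<le> B i j" and \<rho>: "\<And>i. 0 \<le> \<rho> i"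
    and e: "\<And>i. 0 \<le> e i" "\<And>i. e i \<le> \<epsilon>" and \<epsilon>: "0 \<le> \<epsilon>"
  shows "u \<bullet> b + (\<Sum>i\<in>UNIV. v $ i * (1 - e i))
    \<le> (\<Sum>i\<in>UNIV. r i * \<rho> i * (\<Sum>j=1..l i. \<alpha> i j) * (1 - e i)) + u \<bullet> b * \<epsilon>"
proof -
  define w where "w i = r i * \<rho> i * (\<Sum>j=1..l i. \<alpha> i j)" for i
  define q where "q i = u \<bullet> (\<rho> i *\<^sub>R (\<Sum>j=1..l i. \<alpha> i j *\<^sub>R B i j))" for i
  have dual_feas: "dual_feasible r \<rho> l B u v" and feas: "lp_feasible b \<rho> l B (\<lambda>_. 1) \<alpha>"
    using primal dual by (auto simp: lp_optimal_def dual_optimal_def)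
  then have u: "0 \<le> u" and v: "0 \<le> v $ i" for i
    by (auto simp: dual_feasible_def less_eq_vec_def)
  have q: "0 \<le> q i" for i
  proof -
    have "0 \<le> \<rho> i *\<^sub>R (\<Sum>j=1..l i. \<alpha> i j *\<^sub>R B i j)"
      using feas allocations \<rho>
      by (auto simp: lp_feasible_def less_eq_vec_def intro!: mult_nonneg_nonneg sum_nonneg)
    from inner_mono_nonneg[OF u this] show ?thesis by (simp add: q_def)
  qed
  have "e i * w i \<le> v $ i * e i + \<epsilon> * q i" for i
  proof -
    have "w i \<le> v $ i * (\<Sum>j=1..l i. \<alpha> i j) + q i"
      using class_objective_le_dual_price[OF dual_feas] feas by (auto simp: w_def q_def lp_feasible_def)
    also have "\<dots> \<le> v $ i * 1 + q i"
      using feas v by (intro add_right_mono mult_left_mono) (auto simp: lp_feasible_def)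
    finally have "e i * w i \<le> e i * (v $ i + q i)"
      using e by (intro mult_left_mono) auto
    moreover have "e i * q i \<le> \<epsilon> * q i"
      using e q by (intro mult_right_mono) auto
    ultimately show ?thesis by (simp add: algebra_simps)
  qed
  then have "(\<Sum>i\<in>UNIV. e i * w i) \<le> (\<Sum>i\<in>UNIV. v $ i * e i) + \<epsilon> * (\<Sum>i\<in>UNIV. q i)"
    unfolding sum_distrib_left sum.distrib[symmetric] by (intro sum_mono)
  also have "\<epsilon> * (\<Sum>i\<in>UNIV. q i) \<le> \<epsilon> * (u \<bullet> b)"
    unfolding q_def inner_sum_right[symmetric]
    using feas \<epsilon> u by (intro mult_left_mono inner_mono_nonneg) (auto simp: lp_feasible_def)
  finally have "(\<Sum>i\<in>UNIV. e i * w i) \<le> (\<Sum>i\<in>UNIV. v $ i * e i) + \<epsilon> * (u \<bullet> b)" by simp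
  moreover have "u \<bullet> b + (\<Sum>i\<in>UNIV. v $ i) \<le> (\<Sum>i\<in>UNIV. w i)"
    using dual_optimal_le_lp_optimal[OF primal dual]
    by (simp add: dual_objective_def lp_objective_def w_def inner_commute)
  ultimately show ?thesis
    unfolding w_def[symmetric] by (simp add: algebra_simps sum_subtractf)
qed

lemma lp_objective_le_offered:
  assumes "\<And>i. 0 \<le> r i * \<rho> i" "lp_feasible b \<rho> l B c \<alpha>"
  shows "lp_objective r \<rho> l \<alpha> \<le> (\<Sum>i\<in>UNIV. r i * \<rho> i * c i)"
  using assms by (auto simp: lp_objective_def lp_feasible_def intro!: sum_mono mult_left_mono)

lemma lp_value_upper:
  assumes r\<rho>: "\<And>i. 0 \<le> r i * \<rho> i" and feas: "lp_feasible b \<rho> l B c \<alpha>"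
  shows "lp_objective r \<rho> l \<alpha> \<le> lp_value b r \<rho> l B c"
  using feas lp_objective_le_offered[OF r\<rho>] unfolding lp_value_def
  by (intro cSup_upper bdd_aboveI) auto

lemma lp_value_least:
  assumes b: "0 \<le> b" and c: "\<And>i. 0 \<le> c i"
    and bound: "\<And>\<alpha>. lp_feasible b \<rho> l B c \<alpha> \<Longrightarrow> lp_objective r \<rho> l \<alpha> \<le> y"
  shows "lp_value b r \<rho> l B c \<le> y"
proof -
  have "lp_feasible b \<rho> l B c (\<lambda>_ _. 0)"
    using b c by (simp add: lp_feasible_def)
  then show ?thesis
    unfolding lp_value_def using bound by (intro cSup_least) auto
qed

section \<open>The infinite-server queue\<close>

text \<open>
  The \<open>n\<close>-th arrival epoch has an Erlang density, and the sum of these densities is the intensity of the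
  arrival process.  For \<open>x \<ge> 0\<close> it is constant because the arrivals are Poisson; analytically, it is
  the exponential series.
\<close>

lemma suminf_erlang_density:
  assumes "0 < lam"
  shows "(\<Sum>n. ennreal (erlang_density n lam x)) = ennreal lam * indicator {0..} x"
proof (cases "0 \<le> x")
  case True
  have "(\<lambda>n. (lam * x) ^ n /\<^sub>R fact n) sums exp (lam * x)"
    by (rule exp_converges)
  then have "(\<lambda>n. lam * exp (- lam * x) * ((lam * x) ^ n /\<^sub>R fact n)) sums (lam * exp (- lam * x) * exp (lam * x))"
    by (rule sums_mult)
  moreover have "lam * exp (- lam * x) * ((lam * x) ^ n /\<^sub>R fact n) = erlang_density n lam x" for n
    using True by (simp add: erlang_density_def field_simps power_mult_distrib)
  moreover have "lam * exp (- lam * x) * exp (lam * x) = lam"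
    by (simp add: exp_minus)
  ultimately have "(\<lambda>n. erlang_density n lam x) sums lam"
    by (simp only:)
  then have "(\<Sum>n. ennreal (erlang_density n lam x)) = ennreal lam"
    using assms by (intro suminf_ennreal_eq) auto
  with True show ?thesis by simp
qed (simp add: erlang_density_def)

lemma nn_integral_renewal_survival:
  assumes "0 < lam" "0 < m" "0 \<le> t"
  shows "(\<integral>\<^sup>+x. (\<Sum>n. ennreal (erlang_density n lam x)) * ennreal (exp (- m * (t - x)) * indicator {..t} x) \<partial>lborel)
    = ennreal (lam / m * (1 - exp (- m * t)))"
proof -
  have "(\<integral>\<^sup>+x. (\<Sum>n. ennreal (erlang_density n lam x)) * ennreal (exp (- m * (t - x)) * indicator {..t} x) \<partial>lborel)
    = (\<integral>\<^sup>+x. ennreal (lam * exp (- m * (t - x))) * indicator {0..t} x \<partial>lborel)"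
    using assms
    by (intro nn_integral_cong)
      (auto simp: suminf_erlang_density ennreal_mult simp del: suminf_ennreal suminf_ennreal2 split: split_indicator)
  also have "\<dots> = ennreal (lam / m * exp (- m * (t - t)) - lam / m * exp (- m * (t - 0)))"
    using assms
    by (intro nn_integral_FTC_Icc) (auto intro!: derivative_eq_intros)
  finally show ?thesis by (simp add: algebra_simps)
qed

context prob_space
begin

text \<open>
  Given \<open>A = x \<le> t\<close>, the request is still in service at time \<open>t\<close> iff \<open>D > t - x\<close>, which has
  probability \<open>exp (- m * (t - x))\<close>.
\<close>

lemma emeasure_in_service:
  assumes A: "distributed M lborel A f"
    and D: "distributed M lborel D (exponential_density m)" and m: "0 < m"
    and ind: "indep_var borel D borel A"
  shows "emeasure M {\<omega>\<in>space M. A \<omega> \<le> t \<and> t < A \<omega> + D \<omega>}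
    = (\<integral>\<^sup>+x. f x * ennreal (exp (- m * (t - x)) * indicator {..t} x) \<partial>lborel)"
proof -
  have [measurable]: "A \<in> borel_measurable M" "D \<in> borel_measurable M" "f \<in> borel_measurable borel"
    using distributed_measurable[OF A] distributed_measurable[OF D] distributed_borel_measurable[OF A]
    by simp_all
  interpret D: prob_space "distr M borel D" by (rule prob_space_distr) simp
  interpret A: prob_space "distr M borel A" by (rule prob_space_distr) simp
  interpret DA: pair_prob_space "distr M borel D" "distr M borel A" ..
  let ?Q = "{p. snd p \<le> t \<and> t < snd p + fst p} :: (real \<times> real) set"
  have Q[measurable]: "?Q \<in> sets (borel \<Otimes>\<^sub>M borel)"
  proof -
    have "{p \<in> space (borel \<Otimes>\<^sub>M borel). snd p \<le> t \<and> t < snd p + (fst p :: real)} \<in> sets (borel \<Otimes>\<^sub>M borel)"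
      by measurable
    then show ?thesis by (simp add: space_pair_measure)
  qed
  have "emeasure M {\<omega>\<in>space M. A \<omega> \<le> t \<and> t < A \<omega> + D \<omega>}
      = emeasure (distr M (borel \<Otimes>\<^sub>M borel) (\<lambda>\<omega>. (D \<omega>, A \<omega>))) ?Q"
    by (subst emeasure_distr) (auto intro!: arg_cong[of _ _ "emeasure M"])
  also have "\<dots> = emeasure (distr M borel D \<Otimes>\<^sub>M distr M borel A) ?Q"
    using ind by (simp add: indep_var_distribution_eq)
  also have "\<dots> = (\<integral>\<^sup>+x. emeasure (distr M borel D) ((\<lambda>y. (y, x)) -` ?Q) \<partial>distr M borel A)"
    by (rule DA.emeasure_pair_measure_alt2) measurable
  also have "\<dots> = (\<integral>\<^sup>+x. ennreal (exp (- m * (t - x)) * indicator {..t} x) \<partial>distr M borel A)"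
  proof (intro nn_integral_cong)
    fix x :: real
    show "emeasure (distr M borel D) ((\<lambda>y. (y, x)) -` ?Q) = ennreal (exp (- m * (t - x)) * indicator {..t} x)"
    proof (cases "x \<le> t")
      case True
      then have "(\<lambda>y. (y, x)) -` ?Q = {t - x<..}" by auto
      then have "emeasure (distr M borel D) ((\<lambda>y. (y, x)) -` ?Q) = emeasure M {\<omega>\<in>space M. t - x < D \<omega>}"
        by (subst emeasure_distr) (auto intro!: arg_cong[of _ _ "emeasure M"])
      with True show ?thesis
        using exponential_distributedD_gt[OF D _ m, of "t - x"]
        by (simp add: emeasure_eq_measure algebra_simps)
    qed simp
  qed
  also have "\<dots> = (\<integral>\<^sup>+x. f x * ennreal (exp (- m * (t - x)) * indicator {..t} x) \<partial>lborel)"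
    by (subst distributed_nn_integral[OF A]) (auto simp: nn_integral_distr)
  finally show ?thesis .
qed

text \<open>
  The mean number of class \<open>i\<close> requests in the system at time \<open>t\<close> when all of them are accepted.  The sum
  over the requests is exchanged with the integral over the arrival time, so that only the total
  intensity of the arrivals enters.
\<close>

lemma nn_integral_infinite_server_queue:
  fixes X S :: "'c \<Rightarrow> nat \<Rightarrow> 'a \<Rightarrow> real"
  assumes rates: "0 < lam" "0 < m" and t: "0 \<le> t"
    and X: "\<And>n. distributed M lborel (X i n) (exponential_density lam)"
    and S: "\<And>n. distributed M lborel (S i n) (exponential_density m)"
    and ind: "indep_vars (\<lambda>_. borel) (case_sum (\<lambda>(i, n). X i n) (\<lambda>(i, n). S i n)) UNIV"
  shows "(\<integral>\<^sup>+\<omega>. (\<Sum>n. indicator {n. arrival_epoch X i n \<omega> \<le> t \<and> t < arrival_epoch X i n \<omega> + S i n \<omega>} n) \<partial>M)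
    = ennreal (lam / m * (1 - exp (- m * t)))"
proof -
  let ?A = "arrival_epoch X i"
  let ?Z = "case_sum (\<lambda>(i, n). X i n) (\<lambda>(i, n). S i n)"
  let ?I = "\<lambda>n::nat. (\<lambda>k. Inl (i, k)) ` {..n} :: ('c \<times> nat + 'c \<times> nat) set"
  have inj: "inj_on (\<lambda>k. Inl (i, k)) {..n}" for n :: nat
    by (auto simp: inj_on_def)
  have epoch: "?A n = (\<lambda>\<omega>. \<Sum>q\<in>?I n. ?Z q \<omega>)" for n
    by (simp add: arrival_epoch_def sum.reindex[OF inj] fun_eq_iff)
  have [measurable]: "X i n \<in> borel_measurable M" "S i n \<in> borel_measurable M" for n
    using distributed_measurable[OF X] distributed_measurable[OF S] by simp_all
  have [measurable]: "?A n \<in> borel_measurable M" for n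
    unfolding arrival_epoch_def by measurable
  have A: "distributed M lborel (?A n) (erlang_density n lam)" for n
  proof -
    have "distributed M lborel (\<lambda>\<omega>. \<Sum>q\<in>?I n. ?Z q \<omega>) (erlang_density (card (?I n) - 1) lam)"
      using rates X by (intro exponential_distributed_sum indep_vars_subset[OF ind]) auto
    then show ?thesis
      by (simp add: epoch card_image[OF inj])
  qed
  have indA: "indep_var borel (S i n) borel (?A n)" for n
  proof -
    have "indep_var borel (?Z (Inr (i, n))) borel (\<lambda>\<omega>. \<Sum>q\<in>?I n. ?Z q \<omega>)"
      by (intro indep_vars_sum indep_vars_subset[OF ind]) auto
    then show ?thesis
      by (simp add: epoch)
  qed
  have "(\<integral>\<^sup>+\<omega>. (\<Sum>n. indicator {n. ?A n \<omega> \<le> t \<and> t < ?A n \<omega> + S i n \<omega>} n) \<partial>M)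
      = (\<integral>\<^sup>+\<omega>. (\<Sum>n. indicator {\<omega>\<in>space M. ?A n \<omega> \<le> t \<and> t < ?A n \<omega> + S i n \<omega>} \<omega>) \<partial>M)"
    by (intro nn_integral_cong suminf_cong) (auto split: split_indicator)
  also have "\<dots> = (\<Sum>n. emeasure M {\<omega>\<in>space M. ?A n \<omega> \<le> t \<and> t < ?A n \<omega> + S i n \<omega>})"
    by (subst nn_integral_suminf) auto
  also have "\<dots> = (\<Sum>n. \<integral>\<^sup>+x. ennreal (erlang_density n lam x) * ennreal (exp (- m * (t - x)) * indicator {..t} x) \<partial>lborel)"
    using emeasure_in_service[OF A S rates(2) indA] by simp
  also have "\<dots> = (\<integral>\<^sup>+x. (\<Sum>n. ennreal (erlang_density n lam x)) * ennreal (exp (- m * (t - x)) * indicator {..t} x) \<partial>lborel)"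
    by (subst nn_integral_suminf[symmetric]) auto
  also have "\<dots> = ennreal (lam / m * (1 - exp (- m * t)))"
    by (rule nn_integral_renewal_survival[OF rates t])
  finally show ?thesis .
qed

end

text \<open>
  In the application the \<open>F j\<close> are the sets of requests in service under allocation \<open>j\<close>, and \<open>P\<close> is the
  set of requests in service when all are accepted.  Infinite sets \<open>F j\<close> have cardinality \<open>0\<close> and can be
  dropped from the sum.
\<close>

lemma sum_card_le_suminf_indicator:
  fixes F :: "'j \<Rightarrow> nat set"
  assumes J: "finite J" and disj: "disjoint_family_on F J" and sub: "\<And>j. j \<in> J \<Longrightarrow> F j \<subseteq> P"
  shows "ennreal (\<Sum>j\<in>J. real (card (F j))) \<le> (\<Sum>n. indicator P n)"
proof -
  let ?J = "{j\<in>J. finite (F j)}"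
  let ?G = "\<Union>j\<in>?J. F j"
  have fin: "finite ?G" using J by auto
  have "(\<Sum>j\<in>J. card (F j)) = (\<Sum>j\<in>?J. card (F j))"
    using J by (intro sum.mono_neutral_right) auto
  also have "\<dots> = card ?G"
    using J disj by (intro card_UN_disjoint[symmetric]) (auto simp: disjoint_family_on_def)
  finally have "ennreal (\<Sum>j\<in>J. real (card (F j))) = (\<Sum>n\<in>?G. indicator P n)"
    by (subst sum.cong[of ?G ?G _ "\<lambda>_. 1"])
      (use sub in \<open>auto simp: indicator_def subset_iff of_nat_sum[symmetric] ennreal_of_nat_eq_real_of_nat simp del: of_nat_sum\<close>)
  also have "\<dots> \<le> (\<Sum>n. indicator P n)"
    using fin by (intro sum_le_suminf) auto
  finally show ?thesis .
qed

text \<open>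
  The requests in service under the allocations in \<open>J\<close> are, path by path, among those in the
  infinite-server queue driven by the same arrivals and service durations.  The mean content of that
  queue is finite, which gives integrability as well.
\<close>

lemma (in prob_space) expected_class_occupancy_le:
  fixes X S :: "'c \<Rightarrow> nat \<Rightarrow> 'a \<Rightarrow> real"
  assumes rates: "0 < lam" "0 < m" and t: "0 \<le> t"
    and X: "\<And>n. distributed M lborel (X i n) (exponential_density lam)"
    and S: "\<And>n. distributed M lborel (S i n) (exponential_density m)"
    and ind: "indep_vars (\<lambda>_. borel) (case_sum (\<lambda>(i, n). X i n) (\<lambda>(i, n). S i n)) UNIV"
    and a: "\<And>n. a i n \<in> M \<rightarrow>\<^sub>M count_space UNIV" and J: "finite J"
  shows "j \<in> J \<Longrightarrow> integrable M (\<lambda>\<omega>. real (state X S a i j t \<omega>))"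
    and "(\<Sum>j\<in>J. expectation (\<lambda>\<omega>. real (state X S a i j t \<omega>))) \<le> lam / m * (1 - exp (- m * t))"
proof -
  let ?x = "\<lambda>j \<omega>. real (state X S a i j t \<omega>)"
  have [measurable]: "X i n \<in> borel_measurable M" "S i n \<in> borel_measurable M"
    "a i n \<in> M \<rightarrow>\<^sub>M count_space UNIV" for n
    using distributed_measurable[OF X] distributed_measurable[OF S] a by simp_all
  have [measurable]: "?x j \<in> borel_measurable M" for j
    unfolding state_def arrival_epoch_def by measurable
  have le: "(\<integral>\<^sup>+\<omega>. ennreal (\<Sum>j\<in>J. ?x j \<omega>) \<partial>M) \<le> ennreal (lam / m * (1 - exp (- m * t)))"
  proof -
    have "(\<integral>\<^sup>+\<omega>. ennreal (\<Sum>j\<in>J. ?x j \<omega>) \<partial>M)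
      \<le> (\<integral>\<^sup>+\<omega>. (\<Sum>n. indicator {n. arrival_epoch X i n \<omega> \<le> t \<and> t < arrival_epoch X i n \<omega> + S i n \<omega>} n) \<partial>M)"
      unfolding state_def
      by (intro nn_integral_mono sum_card_le_suminf_indicator[OF J])
        (auto simp: disjoint_family_on_def)
    also have "\<dots> = ennreal (lam / m * (1 - exp (- m * t)))"
      by (rule nn_integral_infinite_server_queue[OF rates t X S ind])
    finally show ?thesis .
  qed
  have "integrable M (\<lambda>\<omega>. \<Sum>j\<in>J. ?x j \<omega>)"
    using le by (intro integrableI_nonneg) (auto intro!: sum_nonneg intro: le_less_trans)
  then have int: "integrable M (?x j)" if "j \<in> J" for j
    by (rule Bochner_Integration.integrable_bound) (use that J in \<open>auto intro!: order_trans[OF member_le_sum abs_ge_self]\<close>)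
  then show "j \<in> J \<Longrightarrow> integrable M (?x j)" .
  have "(\<Sum>j\<in>J. expectation (?x j)) = expectation (\<lambda>\<omega>. \<Sum>j\<in>J. ?x j \<omega>)"
    using int by (simp add: Bochner_Integration.integral_sum)
  also have "\<dots> = enn2real (\<integral>\<^sup>+\<omega>. ennreal (\<Sum>j\<in>J. ?x j \<omega>) \<partial>M)"
    by (rule integral_eq_nn_integral) (auto intro!: sum_nonneg)
  also have "\<dots> \<le> enn2real (ennreal (lam / m * (1 - exp (- m * t))))"
    using le by (intro enn2real_mono) auto
  also have "\<dots> = lam / m * (1 - exp (- m * t))"
    using rates t by simp
  finally show "(\<Sum>j\<in>J. expectation (?x j)) \<le> lam / m * (1 - exp (- m * t))" .
qed

section \<open>The bound\<close>

theorem theorem6: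
  fixes M :: "'w measure"
    and b :: "real ^ 'k::finite"
    and lam \<mu> r \<rho> :: "'c::finite \<Rightarrow> real"
    and l :: "'c \<Rightarrow> nat"
    and B :: "'c \<Rightarrow> nat \<Rightarrow> real ^ 'k"
    and X S :: "'c \<Rightarrow> nat \<Rightarrow> 'w \<Rightarrow> real"
    and \<alpha> :: "'c \<Rightarrow> nat \<Rightarrow> real"
    and u :: "real ^ 'k" and v :: "real ^ 'c"
    and a :: "'c \<Rightarrow> nat \<Rightarrow> 'w \<Rightarrow> nat"
    and t :: real
  assumes capacity: "0 \<le> b"
    and rates: "\<And>i. 0 < lam i" "\<And>i. 0 < \<mu> i"
    and rewards: "\<And>i. 0 \<le> r i"
    and load: "\<And>i. \<rho> i = lam i / \<mu> i"
    and allocations: "\<And>i j. j \<in> {1..l i} \<Longrightarrow> 0 \<le> B i j"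
    and prob: "prob_space M"
    and interarrivals: "\<And>i n. distributed M lborel (X i n) (exponential_density (lam i))"
    and services: "\<And>i n. distributed M lborel (S i n) (exponential_density (\<mu> i))"
    and independence: "prob_space.indep_vars M (\<lambda>_. borel)
          (case_sum (\<lambda>(i, n). X i n) (\<lambda>(i, n). S i n)) UNIV"
    and primal_opt: "lp_optimal b r \<rho> l B (\<lambda>_. 1) \<alpha>"
    and dual_opt: "dual_optimal b r \<rho> l B u v"
    and policy: "feasible_policy M b l B X S a"
    and time: "0 \<le> t"
  shows "integrable M (reward_rate r l X S a t) \<and>
    integral\<^sup>L M (reward_rate r l X S a t) \<le> lp_value b r \<rho> l B (\<lambda>i. 1 - exp (- \<mu> i * t)) \<and>
    lp_value b r \<rho> l B (\<lambda>i. 1 - exp (- \<mu> i * t)) \<le>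
      min (\<Sum>i\<in>UNIV. r i * \<rho> i * (1 - exp (- \<mu> i * t)))
          ((\<Sum>i\<in>UNIV. r i * \<rho> i * (\<Sum>j=1..l i. \<alpha> i j) * (1 - exp (- \<mu> i * t)))
            + (u \<bullet> b) * exp (- Min (range \<mu>) * t))"
proof -
  interpret prob_space M by (rule prob)
  let ?x = "\<lambda>i j \<omega>. real (state X S a i j t \<omega>)"
  define c where "c i = 1 - exp (- \<mu> i * t)" for i
  define \<alpha>' where "\<alpha>' i j = expectation (?x i j) / \<rho> i" for i j
  have \<rho>_pos: "0 < \<rho> i" for i
    using rates by (simp add: load)
  have c_nonneg: "0 \<le> c i" for i
    using rates time by (simp add: c_def less_imp_le)
  have a: "a i n \<in> M \<rightarrow>\<^sub>M count_space UNIV" for i n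
    using policy by (simp add: feasible_policy_def)
  have int: "integrable M (?x i j)" if "j \<in> {1..l i}" for i j
    using that
    by (rule expected_class_occupancy_le(1)
        [OF rates time interarrivals services independence a finite_atLeastAtMost])
  have int_linear: "integrable M (\<lambda>\<omega>. \<Sum>i\<in>UNIV. \<Sum>j=1..l i. ?x i j \<omega> * d i j)"
    and expectation_linear: "expectation (\<lambda>\<omega>. \<Sum>i\<in>UNIV. \<Sum>j=1..l i. ?x i j \<omega> * d i j)
      = (\<Sum>i\<in>UNIV. \<Sum>j=1..l i. expectation (?x i j) * d i j)" for d :: "'c \<Rightarrow> nat \<Rightarrow> real"
  proof -
    show "integrable M (\<lambda>\<omega>. \<Sum>i\<in>UNIV. \<Sum>j=1..l i. ?x i j \<omega> * d i j)"
      by (intro Bochner_Integration.integrable_sum integrable_mult_left int)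
    have "expectation (\<lambda>\<omega>. \<Sum>i\<in>UNIV. \<Sum>j=1..l i. ?x i j \<omega> * d i j)
        = (\<Sum>i\<in>UNIV. expectation (\<lambda>\<omega>. \<Sum>j=1..l i. ?x i j \<omega> * d i j))"
      by (intro Bochner_Integration.integral_sum Bochner_Integration.integrable_sum
          integrable_mult_left int)
    also have "\<dots> = (\<Sum>i\<in>UNIV. \<Sum>j=1..l i. expectation (\<lambda>\<omega>. ?x i j \<omega> * d i j))"
      by (intro sum.cong refl Bochner_Integration.integral_sum integrable_mult_left int)
    finally show "expectation (\<lambda>\<omega>. \<Sum>i\<in>UNIV. \<Sum>j=1..l i. ?x i j \<omega> * d i j)
        = (\<Sum>i\<in>UNIV. \<Sum>j=1..l i. expectation (?x i j) * d i j)"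
      by simp
  qed
  have reward_eq: "reward_rate r l X S a t = (\<lambda>\<omega>. \<Sum>i\<in>UNIV. \<Sum>j=1..l i. ?x i j \<omega> * r i)"
    by (simp add: reward_rate_def fun_eq_iff sum_distrib_left mult.commute)
  have occupancy: "(\<Sum>j=1..l i. expectation (?x i j)) \<le> \<rho> i * c i" for i
    unfolding load c_def
    by (rule expected_class_occupancy_le(2)[OF rates time interarrivals services independence a]) auto
  have int_reward: "integrable M (reward_rate r l X S a t)"
    unfolding reward_eq by (rule int_linear)
  have "lp_feasible b \<rho> l B c \<alpha>'"
    unfolding lp_feasible_def
  proof (intro conjI allI ballI)
    show "(\<Sum>i\<in>UNIV. \<rho> i *\<^sub>R (\<Sum>j=1..l i. \<alpha>' i j *\<^sub>R B i j)) \<le> b"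
      unfolding less_eq_vec_def
    proof
      fix k
      have "(\<Sum>i\<in>UNIV. \<rho> i *\<^sub>R (\<Sum>j=1..l i. \<alpha>' i j *\<^sub>R B i j)) $ k
          = (\<Sum>i\<in>UNIV. \<Sum>j=1..l i. expectation (?x i j) * B i j $ k)"
        using \<rho>_pos by (simp add: \<alpha>'_def sum_distrib_left less_imp_neq[symmetric])
      also have "\<dots> = expectation (\<lambda>\<omega>. \<Sum>i\<in>UNIV. \<Sum>j=1..l i. ?x i j \<omega> * B i j $ k)"
        by (rule expectation_linear[symmetric])
      also have "\<dots> \<le> b $ k"
      proof (rule integral_le_const)
        have "AE \<omega> in M. (\<Sum>i\<in>UNIV. \<Sum>j=1..l i. ?x i j \<omega> *\<^sub>R B i j) \<le> b"
          using policy time by (auto simp: feasible_policy_def)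
        then show "AE \<omega> in M. (\<Sum>i\<in>UNIV. \<Sum>j=1..l i. ?x i j \<omega> * B i j $ k) \<le> b $ k"
          by eventually_elim (auto simp: less_eq_vec_def)
      qed (rule int_linear)
      finally show "(\<Sum>i\<in>UNIV. \<rho> i *\<^sub>R (\<Sum>j=1..l i. \<alpha>' i j *\<^sub>R B i j)) $ k \<le> b $ k" .
    qed
  next
    fix i
    show "(\<Sum>j=1..l i. \<alpha>' i j) \<le> c i"
      using occupancy[of i] \<rho>_pos[of i]
      by (simp add: \<alpha>'_def sum_divide_distrib[symmetric] pos_divide_le_eq mult.commute)
  next
    fix i j
    show "0 \<le> \<alpha>' i j"
      using \<rho>_pos[of i] by (simp add: \<alpha>'_def)
  qed
  moreover have "expectation (reward_rate r l X S a t) = lp_objective r \<rho> l \<alpha>'"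
  proof -
    have "expectation (reward_rate r l X S a t) = (\<Sum>i\<in>UNIV. \<Sum>j=1..l i. expectation (?x i j) * r i)"
      unfolding reward_eq by (rule expectation_linear)
    also have "\<dots> = lp_objective r \<rho> l \<alpha>'"
      using \<rho>_pos
      by (simp add: lp_objective_def \<alpha>'_def less_imp_neq[symmetric] sum_distrib_left mult.commute)
    finally show ?thesis .
  qed
  ultimately have reward_le: "expectation (reward_rate r l X S a t) \<le> lp_value b r \<rho> l B c"
    using rewards \<rho>_pos by (auto intro!: lp_value_upper simp: less_imp_le)
  have le_offered: "lp_value b r \<rho> l B c \<le> (\<Sum>i\<in>UNIV. r i * \<rho> i * c i)"
  proof (rule lp_value_least[OF capacity c_nonneg])
    fix \<alpha>'' assume "lp_feasible b \<rho> l B c \<alpha>''"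
    then show "lp_objective r \<rho> l \<alpha>'' \<le> (\<Sum>i\<in>UNIV. r i * \<rho> i * c i)"
      using rewards \<rho>_pos by (intro lp_objective_le_offered) (auto simp: less_imp_le)
  qed
  have "lp_value b r \<rho> l B c \<le> u \<bullet> b + (\<Sum>i\<in>UNIV. v $ i * c i)"
    using dual_opt
    by (intro lp_value_least[OF capacity c_nonneg] lp_weak_duality) (auto simp: dual_optimal_def)
  also have "\<dots> \<le> (\<Sum>i\<in>UNIV. r i * \<rho> i * (\<Sum>j=1..l i. \<alpha> i j) * c i) + u \<bullet> b * exp (- Min (range \<mu>) * t)"
    unfolding c_def
  proof (rule discounted_dual_value_le[OF primal_opt dual_opt allocations])
    show "exp (- \<mu> i * t) \<le> exp (- Min (range \<mu>) * t)" for i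
      using mult_right_mono[OF Min_le[of "range \<mu>" "\<mu> i"] time]
      by (simp del: minus_Min_eq_Max)
  qed (use \<rho>_pos in \<open>auto simp: less_imp_le\<close>)
  finally show ?thesis
    using int_reward reward_le le_offered unfolding c_def by simp
qed

end
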